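(* Let $X,Y,Z$ be real vector spaces, let $F\colon X\rightrightarrows Y$ and $G\colon Y\rightrightarrows Z$ be convex set-valued mappings, and suppose that there exists a triple $(x,y,z)\in X\times Y\times Z$ with $$(x,y)\in\mathrm{core}(\mathrm{gph}(F))\quad\text{and}\quad(y,z)\in\mathrm{core}(\mathrm{gph}(G)).$$ Then for any $(\bar{x},\bar{z})\in\mathrm{gph}(G\circ F)$ and any $h\in Z'$ we have $$D^*(G\circ F)(\bar{x},\bar{z})(h)=D^*F(\bar{x},\bar{y})\circ D^*G(\bar{y},\bar{z})(h)\quad\text{whenever }\bar{y}\in M(\bar{x},\bar{z}),$$ where $M(\bar{x},\bar{z}):=F(\bar{x})\cap G^{-1}(\bar{z})$.
   Context: All vector spaces are real and carry no topology. $X'$ denotes the algebraic dual of $X$ (all linear functions $X\to\mathbb{R}$); $(X\times Y)'$ is identified with $X'\times Y'$ via $(f,g)(x,y)=f(x)+g(y)$. For a subset $\Omega$ of a vector space $W$, $\mathrm{core}(\Omega):=\{x\in\Omega\mid \forall v\in W\ \exists\delta>0\ \forall t\in\mathbb{R}\text{ with }|t|<\delta:\ x+tv\in\Omega\}$. For a nonempty convex $\Omega\subset W$ and $\bar{w}\in\Omega$, $N(\bar{w};\Omega):=\{f\in W'\mid f(w-\bar{w})\le 0\ \forall w\in\Omega\}$. For a set-valued mapping $F\colon X\rightrightarrows Y$ (values are possibly empty subsets of $Y$), $\mathrm{gph}(F):=\{(x,y)\in X\times Y\mid y\in F(x)\}$; $F$ is convex if $\mathrm{gph}(F)$ is convex.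 The coderivative of a convex $F$ at $(\bar{x},\bar{y})\in\mathrm{gph}(F)$ is $D^*F(\bar{x},\bar{y})\colon Y'\rightrightarrows X'$, $D^*F(\bar{x},\bar{y})(g):=\{f\in X'\mid (f,-g)\in N((\bar{x},\bar{y});\mathrm{gph}(F))\}$. The composition of set-valued mappings is $(G\circ F)(x):=\bigcup_{y\in F(x)}G(y)$; accordingly $D^*F(\bar{x},\bar{y})\circ D^*G(\bar{y},\bar{z})(h)=\bigcup_{g\in D^*G(\bar{y},\bar{z})(h)}D^*F(\bar{x},\bar{y})(g)$. Also $G^{-1}(\bar{z}):=\{y\in Y\mid\bar{z}\in G(y)\}$. *)

theory Defs
  imports "HOL-Analysis.Analysis"
begin

text \<open>Real vector spaces are types of class \<open>real_vector\<close>, which carries no topology; \<open>linear\<close> and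
  \<open>convex\<close> are the purely algebraic library notions. A set-valued mapping from \<open>X\<close> to \<open>Y\<close> is a
  function \<open>'x \<Rightarrow> 'y set\<close>.\<close>

definition alg_dual :: "('w::real_vector \<Rightarrow> real) set" where
  "alg_dual = {f. linear f}"

text \<open>The identification of pairs of functionals with functionals on the product space.\<close>

definition dual_pair ::
  "('x::real_vector \<Rightarrow> real) \<Rightarrow> ('y::real_vector \<Rightarrow> real) \<Rightarrow> 'x \<times> 'y \<Rightarrow> real" where
  "dual_pair f g = (\<lambda>(x, y). f x + g y)"

definition alg_core :: "'w::real_vector set \<Rightarrow> 'w set" where
  "alg_core \<Omega> = {x \<in> \<Omega>. \<forall>v. \<exists>\<delta>>0. \<forall>t::real. \<bar>t\<bar> < \<delta> \<longrightarrow> x + t *\<^sub>R v \<in> \<Omega>}"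

text \<open>Meaningful for convex \<open>\<Omega>\<close> and \<open>w \<in> \<Omega>\<close>; these conditions are left to the places of use.\<close>

definition normal_cone :: "'w::real_vector \<Rightarrow> 'w set \<Rightarrow> ('w \<Rightarrow> real) set" where
  "normal_cone w \<Omega> = {f \<in> alg_dual. \<forall>u\<in>\<Omega>. f (u - w) \<le> 0}"

definition gph :: "('x \<Rightarrow> 'y set) \<Rightarrow> ('x \<times> 'y) set" where
  "gph F = {(x, y). y \<in> F x}"

definition convex_map :: "('x::real_vector \<Rightarrow> 'y::real_vector set) \<Rightarrow> bool" where
  "convex_map F \<longleftrightarrow> convex (gph F)"

text \<open>The coderivative at \<open>(x, y)\<close>, a set-valued mapping from \<open>Y'\<close> to \<open>X'\<close>. For \<open>g\<close> outside \<open>Y'\<close>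
  its value is empty, since \<open>dual_pair f (- g)\<close> is then not linear.\<close>

definition coderivative ::
  "('x::real_vector \<Rightarrow> 'y::real_vector set) \<Rightarrow> 'x \<times> 'y \<Rightarrow> ('y \<Rightarrow> real) \<Rightarrow> ('x \<Rightarrow> real) set" where
  "coderivative F p g = {f \<in> alg_dual. dual_pair f (\<lambda>y. - g y) \<in> normal_cone p (gph F)}"

definition set_comp :: "('b \<Rightarrow> 'c set) \<Rightarrow> ('a \<Rightarrow> 'b set) \<Rightarrow> 'a \<Rightarrow> 'c set" where
  "set_comp G F x = (\<Union>y\<in>F x. G y)"

definition set_inverse :: "('a \<Rightarrow> 'b set) \<Rightarrow> 'b \<Rightarrow> 'a set" where
  "set_inverse G z = {y. z \<in> G y}"

definition intermediate :: "('x \<Rightarrow> 'y set) \<Rightarrow> ('y \<Rightarrow> 'z set) \<Rightarrow> 'x \<Rightarrow> 'z \<Rightarrow> 'y set" where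
  "intermediate F G x z = F x \<inter> set_inverse G z"

end

theory Submission
  imports Defs
begin

text \<open>A functional \<open>f\<close> lies in the coderivative of \<open>G \<circ> F\<close> at \<open>h\<close> iff \<open>h (z - zb) - f (x - xb) \<ge> 0\<close>
  whenever \<open>y \<in> F x\<close> and \<open>z \<in> G y\<close>. Decouple the two occurrences of \<open>y\<close>: the set of all
  \<open>(y1 - y2, h (z - zb) - f (x - xb))\<close> with \<open>y1 \<in> F x\<close> and \<open>z \<in> G y2\<close> is convex, its projection to
  \<open>Y\<close> absorbs every direction because of the core condition, and over \<open>0\<close> it is nonnegative. Hence it
  lies above the graph of a linear functional \<open>k\<close>, and \<open>g = - k\<close> is the required intermediate
  functional: set \<open>(y2, z) = (yb, zb)\<close>, respectively \<open>(x, y1) = (xb, yb)\<close>.\<close>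

section \<open>Sublinear functionals\<close>

definition sublinear :: "('w::real_vector \<Rightarrow> real) \<Rightarrow> bool" where
  "sublinear p \<longleftrightarrow> (\<forall>x y. p (x + y) \<le> p x + p y) \<and> (\<forall>t>0. \<forall>x. p (t *\<^sub>R x) = t * p x)"

lemma sublinear_add: "sublinear p \<Longrightarrow> p (x + y) \<le> p x + p y"
  by (simp add: sublinear_def)

lemma sublinear_scale_pos: "sublinear p \<Longrightarrow> t > 0 \<Longrightarrow> p (t *\<^sub>R x) = t * p x"
  by (simp add: sublinear_def)

lemma sublinear_zero: "sublinear p \<Longrightarrow> p 0 = 0"
  using sublinear_scale_pos[of p 2 0] by simp

lemma sublinear_scale: "sublinear p \<Longrightarrow> t \<ge> 0 \<Longrightarrow> p (t *\<^sub>R x) = t * p x"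
  by (cases "t = 0") (auto simp: sublinear_zero sublinear_scale_pos)

lemma sublinear_minus: "sublinear p \<Longrightarrow> - p (- x) \<le> p x"
  using sublinear_add[of p x "- x"] sublinear_zero[of p] by simp

text \<open>Applying the second inequality with \<open>inverse t\<close> to
  \<open>t *\<^sub>R x\<close> yields the reverse one, so one direction of homogeneity is
  enough.\<close>

lemma sublinearI:
  assumes "\<And>x y. p (x + y) \<le> p x + p y" and "\<And>t x. t > 0 \<Longrightarrow> p (t *\<^sub>R x) \<le> t * p x"
  shows "sublinear p"
proof -
  have "t * p x \<le> p (t *\<^sub>R x)" if "t > 0" for t x
    using assms(2)[of "inverse t" "t *\<^sub>R x"] that by (simp add: field_simps)
  then show ?thesis
    unfolding sublinear_def using assms by (auto intro!: antisym)
qed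

text \<open>Once signs can be pulled out, subadditivity at \<open>- x\<close>, \<open>- y\<close> is
  superadditivity at \<open>x\<close>, \<open>y\<close>, and negative scalars reduce to positive
  ones.\<close>

lemma linear_if_sublinear_odd:
  assumes p: "sublinear p" and odd: "\<And>x. p (- x) \<le> - p x"
  shows "linear p"
proof -
  have neg: "p (- x) = - p x" for x
    using odd[of x] sublinear_minus[OF p, of x] by linarith
  show ?thesis
  proof (rule linearI)
    fix x y
    show "p (x + y) = p x + p y"
      using sublinear_add[OF p, of x y] sublinear_add[OF p, of "- x" "- y"]
        neg[of x] neg[of y] neg[of "x + y"] by simp
  next
    fix t :: real and x
    show "p (t *\<^sub>R x) = t *\<^sub>R p x"
      using sublinear_scale[OF p, of t x] sublinear_scale[OF p, of "- t" x] neg[of "t *\<^sub>R x"]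
      by (cases "t \<ge> 0") auto
  qed
qed

lemma sublinear_Inf_chain:
  fixes C :: "('w::real_vector \<Rightarrow> real) set"
  assumes ne: "C \<noteq> {}" and sub: "\<And>q. q \<in> C \<Longrightarrow> sublinear q"
    and chain: "\<And>q r. q \<in> C \<Longrightarrow> r \<in> C \<Longrightarrow> q \<le> r \<or> r \<le> q"
  shows "sublinear (\<lambda>x. INF q\<in>C. q x)" and "\<And>q x. q \<in> C \<Longrightarrow> (INF q\<in>C. q x) \<le> q x"
proof -
  obtain p where p: "p \<in> C" using ne by blast
  \<comment> \<open>Comparing \<open>q\<close> with the fixed member \<open>p\<close> bounds
    \<open>q x\<close> below independently of \<open>q\<close>, so the infimum is a genuine
    one.\<close>
  have low: "min (- p (- x)) (p x) \<le> q x" if "q \<in> C" for q x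
  proof -
    have "q \<le> p \<or> p \<le> q" using chain that p by blast
    then have "q (- x) \<le> p (- x) \<or> p x \<le> q x" by (auto simp: le_fun_def)
    then show ?thesis using sublinear_minus[OF sub[OF that], of x] by linarith
  qed
  have bdd: "bdd_below ((\<lambda>q. q x) ` C)" for x
    using low by (intro bdd_belowI2)
  show le: "(INF q\<in>C. q x) \<le> q x" if "q \<in> C" for q x
    using bdd that by (rule cINF_lower)
  show "sublinear (\<lambda>x. INF q\<in>C. q x)"
  proof (rule sublinearI)
    fix x y
    have "(INF q\<in>C. q (x + y)) - q x \<le> r y" if q: "q \<in> C" and r: "r \<in> C" for q r
    proof -
      \<comment> \<open>The smaller of \<open>q\<close> and \<open>r\<close> serves as
        \<open>s\<close>. Bounding both summands by values of one functional is what makes the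
        infimum subadditive.\<close>
      obtain s where s: "s \<in> C" "s \<le> q" "s \<le> r" using chain[OF q r] q r by blast
      then have "s (x + y) \<le> q x + r y"
        using sublinear_add[OF sub[OF s(1)], of x y] by (force simp: le_fun_def intro: order_trans add_mono)
      then show ?thesis using le[OF s(1), of "x + y"] by linarith
    qed
    then have "(INF q\<in>C. q (x + y)) - q x \<le> (INF r\<in>C. r y)" if "q \<in> C" for q
      using that by (intro cINF_greatest ne)
    then have "(INF q\<in>C. q (x + y)) - (INF r\<in>C. r y) \<le> (INF q\<in>C. q x)"
      by (intro cINF_greatest ne) (simp add: algebra_simps)
    then show "(INF q\<in>C. q (x + y)) \<le> (INF q\<in>C. q x) + (INF q\<in>C. q y)" by simp
  next
    fix t :: real and x assume t: "t > 0"
    have "(INF q\<in>C. q (t *\<^sub>R x)) / t \<le> q x" if "q \<in> C" for q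
      using le[OF that, of "t *\<^sub>R x"] sublinear_scale_pos[OF sub[OF that] t, of x] t
      by (simp add: field_simps)
    then have "(INF q\<in>C. q (t *\<^sub>R x)) / t \<le> (INF q\<in>C. q x)"
      by (intro cINF_greatest ne)
    then show "(INF q\<in>C. q (t *\<^sub>R x)) \<le> t * (INF q\<in>C. q x)"
      using t by (simp add: field_simps)
  qed
qed

text \<open>Lowering \<open>p\<close> so that its value at \<open>- y\<close> drops to at most \<open>- p y\<close>; a minimal sublinear functional
  is therefore odd.\<close>

lemma sublinear_lower:
  assumes p: "sublinear p"
  obtains q where "sublinear q" and "q \<le> p" and "q (- y) \<le> - p y"
proof -
  \<comment> \<open>The parameter \<open>t = 0\<close> gives \<open>q \<le> p\<close>, and
    \<open>t = 1\<close> at the point \<open>- y\<close> gives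
    \<open>p 0 - p y = - p y\<close>.\<close>
  define q where "q = (\<lambda>x. INF t\<in>{0..}. p (x + t *\<^sub>R y) - t * p y)"
  have low: "- p (- x) \<le> p (x + t *\<^sub>R y) - t * p y" if "t \<ge> 0" for x and t :: real
    using sublinear_add[OF p, of "- x" "x + t *\<^sub>R y"] sublinear_scale[OF p that, of y] by simp
  have bdd: "bdd_below ((\<lambda>t. p (x + t *\<^sub>R y) - t * p y) ` {0..})" for x
    using low by (intro bdd_belowI2) auto
  have le: "q x \<le> p (x + t *\<^sub>R y) - t * p y" if "t \<ge> 0" for x t
    unfolding q_def using bdd that by (intro cINF_lower) auto
  have ge: "c \<le> q x" if "\<And>t. t \<ge> 0 \<Longrightarrow> c \<le> p (x + t *\<^sub>R y) - t * p y" for c x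
    unfolding q_def using that by (intro cINF_greatest) auto
  have "sublinear q"
  proof (rule sublinearI)
    fix a b
    \<comment> \<open>Parameters add: \<open>s\<close> for \<open>a\<close> and \<open>t\<close> for
      \<open>b\<close> make \<open>s + t\<close> admissible for \<open>a + b\<close>.\<close>
    have "q (a + b) - (p (a + s *\<^sub>R y) - s * p y) \<le> p (b + t *\<^sub>R y) - t * p y"
      if "s \<ge> 0" "t \<ge> 0" for s t
      using le[of "s + t" "a + b"] that sublinear_add[OF p, of "a + s *\<^sub>R y" "b + t *\<^sub>R y"]
      by (simp add: algebra_simps)
    then have "q (a + b) - (p (a + s *\<^sub>R y) - s * p y) \<le> q b" if "s \<ge> 0" for s
      using that by (intro ge)
    then have "q (a + b) - q b \<le> q a"
      by (intro ge) (simp add: algebra_simps)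
    then show "q (a + b) \<le> q a + q b" by simp
  next
    fix t :: real and x assume t: "t > 0"
    have "q (t *\<^sub>R x) / t \<le> q x"
    proof (rule ge)
      fix s :: real assume s: "s \<ge> 0"
      have "q (t *\<^sub>R x) \<le> p (t *\<^sub>R (x + s *\<^sub>R y)) - (t * s) * p y"
        using le[of "t * s" "t *\<^sub>R x"] s t by (simp add: scaleR_add_right)
      also have "\<dots> = t * (p (x + s *\<^sub>R y) - s * p y)"
        by (simp only: sublinear_scale_pos[OF p t]) (simp add: algebra_simps)
      finally show "q (t *\<^sub>R x) / t \<le> p (x + s *\<^sub>R y) - s * p y"
        using t by (simp add: field_simps)
    qed
    then show "q (t *\<^sub>R x) \<le> t * q x" using t by (simp add: field_simps)
  qed
  moreover have "q \<le> p"
    using le[of 0] by (simp add: le_fun_def)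
  moreover have "q (- y) \<le> - p y"
    using le[of 1 "- y"] sublinear_zero[OF p] by simp
  ultimately show ?thesis using that by blast
qed

section \<open>The Hahn-Banach theorem\<close>

theorem hahn_banach_sublinear:
  fixes p :: "'w::real_vector \<Rightarrow> real"
  assumes p: "sublinear p"
  obtains g where "linear g" and "\<And>x. g x \<le> p x"
proof -
  define A where "A = {q. sublinear q \<and> q \<le> p}"
  \<comment> \<open>Zorn's lemma is applied to the reversed order, so that its maximal elements are
    minimal functionals and its upper bounds are pointwise infima.\<close>
  have "\<exists>m\<in>A. \<forall>a\<in>A. m \<ge> a \<longrightarrow> a = m"
  proof (rule predicate_Zorn)
    show "partial_order_on A (relation_of (\<ge>) A)"
      by (rule partial_order_on_relation_ofI) auto
  next
    fix C assume "C \<in> Chains (relation_of (\<ge>) A)"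
    then have CA: "C \<subseteq> A" and chain: "\<And>q r. q \<in> C \<Longrightarrow> r \<in> C \<Longrightarrow> q \<le> r \<or> r \<le> q"
      by (auto simp: Chains_def relation_of_def)
    show "\<exists>u\<in>A. \<forall>a\<in>C. a \<ge> u"
    \<comment> \<open>The empty chain is bounded by \<open>p\<close> itself, since an infimum over
      the empty set carries no information.\<close>
    proof (cases "C = {}")
      case True
      then show ?thesis using p by (auto simp: A_def)
    next
      case False
      let ?u = "\<lambda>x. INF q\<in>C. q x"
      have sub: "\<And>q. q \<in> C \<Longrightarrow> sublinear q" using CA by (auto simp: A_def)
      have low: "?u \<le> q" if "q \<in> C" for q
        using sublinear_Inf_chain(2)[OF False sub chain] that by (simp add: le_fun_def)
      moreover have "sublinear ?u"
        using sublinear_Inf_chain(1)[OF False sub chain] by simp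
      moreover have "?u \<le> p"
        using False CA low by (auto simp: A_def intro: order_trans)
      ultimately show ?thesis unfolding A_def by blast
    qed
  qed
  then obtain m where m: "sublinear m" "m \<le> p" and min: "\<And>a. a \<in> A \<Longrightarrow> a \<le> m \<Longrightarrow> a = m"
    by (auto simp: A_def)
  have "m (- y) \<le> - m y" for y
  proof -
    obtain q where q: "sublinear q" "q \<le> m" "q (- y) \<le> - m y"
      using sublinear_lower[OF m(1)] by blast
    then have "q = m" using min[of q] m(2) by (auto simp: A_def)
    then show ?thesis using q(3) by simp
  qed
  then show ?thesis
    using that[of m] linear_if_sublinear_odd[OF m(1)] m(2) by (auto simp: le_fun_def)
qed

section \<open>Linear functionals below a convex set\<close>

text \<open>The sublinear functional used here is the infimum of all slopes \<open>r / t\<close> with \<open>(t u, r) \<in> C\<close>,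
  \<open>t > 0\<close>.\<close>

theorem convex_set_above_linear:
  fixes C :: "('w::real_vector \<times> real) set"
  assumes conv: "convex C"
    and absorb: "\<And>u. \<exists>t>0. \<exists>r. (t *\<^sub>R u, r) \<in> C"
    and nonneg: "\<And>r. (0, r) \<in> C \<Longrightarrow> r \<ge> 0"
  obtains g where "linear g" and "\<And>u r. (u, r) \<in> C \<Longrightarrow> g u \<le> r"
proof -
  define S where "S = (\<lambda>u. {r / t | r t. t > 0 \<and> (t *\<^sub>R u, r) \<in> C})"
  have S_ne: "S u \<noteq> {}" for u
    using absorb[of u] by (auto simp: S_def)
  have S_add: "a + b \<in> S (u + v)" if "a \<in> S u" "b \<in> S v" for a b u v
  proof -
    obtain r s t q where a: "a = r / t" "t > 0" "(t *\<^sub>R u, r) \<in> C"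
      and b: "b = q / s" "s > 0" "(s *\<^sub>R v, q) \<in> C"
      using \<open>a \<in> S u\<close> \<open>b \<in> S v\<close> by (auto simp: S_def)
    \<comment> \<open>The weights \<open>s / (s + t)\<close> and \<open>t / (s + t)\<close> turn
      \<open>t *\<^sub>R u\<close> and \<open>s *\<^sub>R v\<close> into multiples with the same
      factor \<open>?l\<close>, so the convex combination lies over a multiple of
      \<open>u + v\<close>.\<close>
    let ?l = "t * s / (s + t)"
    have st: "s + t > 0" using a b by simp
    then have "s / (s + t) + t / (s + t) = 1"
      unfolding add_divide_distrib[symmetric] by simp
    then have "(s / (s + t)) *\<^sub>R (t *\<^sub>R u, r) + (t / (s + t)) *\<^sub>R (s *\<^sub>R v, q) \<in> C"
      using a b by (intro convexD[OF conv]) auto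
    then have "(?l *\<^sub>R (u + v), (s * r + t * q) / (s + t)) \<in> C"
      by (simp add: scaleR_add_right add_divide_distrib mult.commute)
    moreover have "a + b = ((s * r + t * q) / (s + t)) / ?l"
    proof -
      have "a + b = (s * r + t * q) / (t * s)" using a b by (simp add: field_simps)
      also have "\<dots> = ((s * r + t * q) / (s + t)) / ?l" using st by simp
      finally show ?thesis .
    qed
    moreover have "?l > 0" using a b st by simp
    ultimately show ?thesis unfolding S_def by blast
  qed
  have S_zero: "a \<ge> 0" if "a \<in> S 0" for a
    using that nonneg by (auto simp: S_def)
  \<comment> \<open>A slope at \<open>u\<close> plus a slope at \<open>- u\<close> is a slope at
    \<open>0\<close>, hence nonnegative; a single slope at \<open>- u\<close> thus bounds all of
    \<open>S u\<close>.\<close>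
  have bdd: "bdd_below (S u)" for u
  proof -
    obtain b where "b \<in> S (- u)" using S_ne by blast
    then have "- b \<le> a" if "a \<in> S u" for a
      using S_zero S_add[OF that, of b "- u"] by fastforce
    then show ?thesis by (rule bdd_belowI)
  qed
  define p where "p = (\<lambda>u. Inf (S u))"
  have le: "p u \<le> a" if "a \<in> S u" for u a
    unfolding p_def using that bdd by (intro cInf_lower)
  have ge: "c \<le> p u" if "\<And>a. a \<in> S u \<Longrightarrow> c \<le> a" for u c
    unfolding p_def using that S_ne by (intro cInf_greatest)
  have "sublinear p"
  proof (rule sublinearI)
    fix u v
    have "p (u + v) - a \<le> b" if "a \<in> S u" "b \<in> S v" for a b
      using le[OF S_add[OF that]] by simp
    then have "p (u + v) - a \<le> p v" if "a \<in> S u" for a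
      using that by (intro ge)
    then have "p (u + v) - p v \<le> p u"
      by (intro ge) (simp add: algebra_simps)
    then show "p (u + v) \<le> p u + p v" by simp
  next
    fix c :: real and u assume c: "c > 0"
    have "c * a \<in> S (c *\<^sub>R u)" if "a \<in> S u" for a
    proof -
      from that obtain r t where "a = r / t" "t > 0" "(t *\<^sub>R u, r) \<in> C"
        by (auto simp: S_def)
      then have "c * a = r / (t / c) \<and> t / c > 0 \<and> ((t / c) *\<^sub>R (c *\<^sub>R u), r) \<in> C"
        using c by simp
      then show ?thesis unfolding S_def by blast
    qed
    then have "p (c *\<^sub>R u) / c \<le> p u"
      using le c by (intro ge) (simp add: field_simps)
    then show "p (c *\<^sub>R u) \<le> c * p u" using c by (simp add: field_simps)
  qed
  then obtain g where g: "linear g" "\<And>u. g u \<le> p u"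
    using hahn_banach_sublinear by blast
  have "g u \<le> r" if "(u, r) \<in> C" for u r
  proof -
    have "r = r / 1 \<and> (1::real) > 0 \<and> (1 *\<^sub>R u, r) \<in> C" using that by simp
    then have "r \<in> S u" unfolding S_def by blast
    then show ?thesis using le g(2) order_trans by blast
  qed
  then show ?thesis using that g(1) by blast
qed

section \<open>Coderivatives as inequalities\<close>

lemma linear_dual_pair: "linear f \<Longrightarrow> linear g \<Longrightarrow> linear (dual_pair f g)"
  by (rule linearI) (auto simp: dual_pair_def linear_add linear_scale algebra_simps)

lemma coderivative_iff:
  assumes "linear g"
  shows "f \<in> coderivative F (xb, yb) g \<longleftrightarrow>
    linear f \<and> (\<forall>x. \<forall>y\<in>F x. f (x - xb) \<le> g (y - yb))"
  using linear_dual_pair[of f "\<lambda>y. - g y"] linear_compose_neg[OF assms]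
  by (auto simp: coderivative_def normal_cone_def alg_dual_def gph_def dual_pair_def)

text \<open>Since \<open>f 0 = 0\<close>, restricting the linear functional
  \<open>dual_pair f (\<lambda>y. - g y)\<close> to the pairs \<open>(0, y)\<close> recovers
  \<open>- g\<close>.\<close>

lemma coderivative_imp_linear:
  assumes "f \<in> coderivative F p g"
  shows "linear g"
proof -
  have f: "linear f" and D: "linear (dual_pair f (\<lambda>y. - g y))"
    using assms by (auto simp: coderivative_def normal_cone_def alg_dual_def)
  have eq: "g = (\<lambda>y. - dual_pair f (\<lambda>y. - g y) (0, y))"
    using linear_0[OF f] by (auto simp: dual_pair_def)
  have "linear (\<lambda>y. dual_pair f (\<lambda>y. - g y) (0, y))"
    using linear_compose[OF _ D, of "\<lambda>y. (0, y)"] by (simp add: o_def linear_iff)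
  then show ?thesis
    by (subst eq) (rule linear_compose_neg)
qed

section \<open>Interpolation and the chain rule\<close>

text \<open>With \<open>A\<close> and \<open>B\<close> the graphs of \<open>F\<close> and
  \<open>G\<close>, the two inequalities for \<open>g\<close> say that \<open>g\<close> is the
  intermediate functional of the composed coderivatives.\<close>

lemma linear_interpolation:
  fixes A :: "('x::real_vector \<times> 'y::real_vector) set" and B :: "('y \<times> 'z::real_vector) set"
    and f :: "'x \<Rightarrow> real" and h :: "'z \<Rightarrow> real"
  assumes conv: "convex A" "convex B"
    and core: "(x0, y0) \<in> alg_core A" "(y0, z0) \<in> B"
    and lin: "linear f" "linear h"
    and le: "\<And>x y z. (x, y) \<in> A \<Longrightarrow> (y, z) \<in> B \<Longrightarrow> f (x - xb) \<le> h (z - zb)"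
    and mem: "(xb, yb) \<in> A" "(yb, zb) \<in> B"
  obtains g where "linear g"
    and "\<And>x y. (x, y) \<in> A \<Longrightarrow> f (x - xb) \<le> g (y - yb)"
    and "\<And>y z. (y, z) \<in> B \<Longrightarrow> g (y - yb) \<le> h (z - zb)"
proof -
  define L where "L = (\<lambda>((x, y1), (y2, z)). (y1 - y2 :: 'y, h z - f x))"
  \<comment> \<open>The translation by \<open>c\<close> accounts for the base points
    \<open>xb\<close> and \<open>zb\<close>; \<open>C\<close> is then a translate of a linear image
    of \<open>A \<times> B\<close>, which gives its convexity.\<close>
  define c where "c = (0 :: 'y, f xb - h zb)"
  define C where "C = (+) c ` L ` (A \<times> B)"
  have C: "(u, r) \<in> C \<longleftrightarrow> (\<exists>x y1 y2 z. (x, y1) \<in> A \<and> (y2, z) \<in> B \<and>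
      u = y1 - y2 \<and> r = h (z - zb) - f (x - xb))" for u r
    unfolding C_def L_def c_def
    by (force simp: image_iff linear_diff[OF lin(1)] linear_diff[OF lin(2)])
  have "linear L"
    by (rule linearI)
      (auto simp: L_def linear_add[OF lin(1)] linear_add[OF lin(2)] linear_scale[OF lin(1)]
        linear_scale[OF lin(2)] algebra_simps)
  then have "convex C"
    unfolding C_def using conv by (intro convex_translation convex_linear_image convex_Times)
  moreover have "\<exists>t>0. \<exists>r. (t *\<^sub>R u, r) \<in> C" for u
  proof -
    \<comment> \<open>Only \<open>y0\<close> in the first pair is moved, along
      \<open>(0, u)\<close>, while \<open>(y0, z0)\<close> stays fixed; the difference of the two
      \<open>Y\<close> components is then a positive multiple of \<open>u\<close>.\<close>
    obtain \<delta> where \<delta>: "\<delta> > 0" "\<And>t::real. \<bar>t\<bar> < \<delta> \<Longrightarrow> (x0, y0) + t *\<^sub>R (0, u) \<in> A"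
      using core(1) unfolding alg_core_def by blast
    then have "(x0, y0 + (\<delta> / 2) *\<^sub>R u) \<in> A"
      using \<delta>(2)[of "\<delta> / 2"] by simp
    then have "((\<delta> / 2) *\<^sub>R u, h (z0 - zb) - f (x0 - xb)) \<in> C"
      unfolding C using core(2) by (metis add_diff_cancel_left')
    then show ?thesis using \<delta>(1) half_gt_zero by blast
  qed
  moreover have "r \<ge> 0" if "(0, r) \<in> C" for r
  proof -
    \<comment> \<open>First component \<open>0\<close> means that both \<open>Y\<close> components
      agree, so \<open>le\<close> applies.\<close>
    from that obtain x y z where "(x, y) \<in> A" "(y, z) \<in> B" "r = h (z - zb) - f (x - xb)"
      unfolding C by auto
    then show ?thesis using le by simp
  qed
  ultimately obtain k where k: "linear k" "\<And>u r. (u, r) \<in> C \<Longrightarrow> k u \<le> r"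
    using convex_set_above_linear by blast
  have key: "k (y1 - y2) \<le> h (z - zb) - f (x - xb)" if "(x, y1) \<in> A" "(y2, z) \<in> B" for x y1 y2 z
    using k(2) C that by blast
  have zero: "f 0 = 0" "h 0 = 0"
    using lin by (simp_all add: linear_0)
  show ?thesis
  proof (rule that[of "\<lambda>y. - k y"])
    show "linear (\<lambda>y. - k y)" using k(1) by (rule linear_compose_neg)
    show "f (x - xb) \<le> - k (y - yb)" if "(x, y) \<in> A" for x y
      using key[OF that mem(2)] zero by simp
    show "- k (y - yb) \<le> h (z - zb)" if "(y, z) \<in> B" for y z
      using key[OF mem(1) that] zero linear_diff[OF k(1)] by simp
  qed
qed

theorem theorem7p1:
  fixes F :: "'x::real_vector \<Rightarrow> 'y::real_vector set"
    and G :: "'y \<Rightarrow> 'z::real_vector set"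
  assumes "convex_map F"
    and "convex_map G"
    and "\<exists>x y z. (x, y) \<in> alg_core (gph F) \<and> (y, z) \<in> alg_core (gph G)"
  shows "\<forall>xb zb. (xb, zb) \<in> gph (set_comp G F) \<longrightarrow>
           (\<forall>h\<in>alg_dual. \<forall>yb\<in>intermediate F G xb zb.
              coderivative (set_comp G F) (xb, zb) h =
              set_comp (coderivative F (xb, yb)) (coderivative G (yb, zb)) h)"
proof (intro allI impI ballI set_eqI iffI)
  fix xb zb yb and h :: "'z \<Rightarrow> real" and f :: "'x \<Rightarrow> real"
  assume "h \<in> alg_dual" and yb: "yb \<in> intermediate F G xb zb"
  then have h: "linear h" by (simp add: alg_dual_def)
  {
    assume "f \<in> coderivative (set_comp G F) (xb, zb) h"
    then have f: "linear f"
      and le: "\<And>x y z. y \<in> F x \<Longrightarrow> z \<in> G y \<Longrightarrow> f (x - xb) \<le> h (z - zb)"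
      by (auto simp: coderivative_iff[OF h] set_comp_def)
    obtain x0 y0 z0 where "(x0, y0) \<in> alg_core (gph F)" "(y0, z0) \<in> gph G"
      using assms(3) by (auto simp: alg_core_def)
    then obtain g where g: "linear g"
      "\<And>x y. (x, y) \<in> gph F \<Longrightarrow> f (x - xb) \<le> g (y - yb)"
      "\<And>y z. (y, z) \<in> gph G \<Longrightarrow> g (y - yb) \<le> h (z - zb)"
      using linear_interpolation[of "gph F" "gph G" x0 y0 z0 f h xb zb yb] assms(1,2) f h le yb
      by (auto simp: convex_map_def gph_def intermediate_def set_inverse_def)
    then have "g \<in> coderivative G (yb, zb) h" "f \<in> coderivative F (xb, yb) g"
      using f by (auto simp: coderivative_iff h gph_def)
    then show "f \<in> set_comp (coderivative F (xb, yb)) (coderivative G (yb, zb)) h"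
      by (auto simp: set_comp_def)
  }
  {
    assume "f \<in> set_comp (coderivative F (xb, yb)) (coderivative G (yb, zb)) h"
    \<comment> \<open>The converse inclusion chains
      \<open>f (x - xb) \<le> g (y - yb) \<le> h (z - zb)\<close> through each intermediate
      \<open>y\<close>.\<close>
    then obtain g where g: "g \<in> coderivative G (yb, zb) h" and f: "f \<in> coderivative F (xb, yb) g"
      by (auto simp: set_comp_def)
    then show "f \<in> coderivative (set_comp G F) (xb, zb) h"
      using coderivative_imp_linear[OF f]
      by (auto simp: coderivative_iff h set_comp_def) (meson order_trans)
  }
qed

end
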